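(* Let $\mathbf{Var}:\mathbb{R}^{<\mathbb{N}}\to\mathbb{R}$ be the variance function on the data universe of all finite-length real-valued vectors. For any fixed parameter $\Delta\ge 0$, there is a function $g:\mathbb{R}^{<\mathbb{N}}\to\mathbb{R}$ with sensitivity $\Delta$, together with an algorithm that, for any database $D=(x_1,\dots,x_n)$, computes $g(D)$ in $O(n^2)$ time, such that for every such $D$ \[ |g(D)-\mathbf{Var}(D)|\le \max\left\{\mathbf{Var}(D)-\frac{n}{2}\Delta,\,0\right\}+\sum_{i=1}^n\max\left\{\sum_{j=1}^n\frac{4(x_i-x_j)^2}{n^2}-\Delta,\,0\right\}. \]
   Context: $\mathbb{R}^{<\mathbb{N}}$ denotes the set of all finite-length real vectors (databases), each entry being the data of one individual. For $D=(x_1,\dots,x_n)$, $\mu(D)=\frac1n\sum_i x_i$ and $\mathbf{Var}(D)=\frac1n\sum_{i=1}^n(x_i-\mu(D))^2=\frac1{n^2}\sum_{i,j}\frac12(x_i-x_j)^2$; $\mathbf{Var}(\emptyset)=0$. Two databases are neighbors if one is obtained from the other by adding (or removing) a single entry; $g$ has sensitivity $\Delta$ if $|g(D)-g(D')|\le\Delta$ for all neighboring $D,D'$. *)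

theory Defs
  imports Complex_Main "HOL-Library.Landau_Symbols"
begin

section \<open>Databases, variance and sensitivity\<close>

definition mean :: "real list \<Rightarrow> real" where
  "mean D = (\<Sum>x\<leftarrow>D. x) / real (length D)"

text \<open>The convention that the empty database has variance 0 is what division by zero gives.\<close>

definition Var :: "real list \<Rightarrow> real" where
  "Var D = (\<Sum>x\<leftarrow>D. (x - mean D)\<^sup>2) / real (length D)"

lemma Var_Nil: "Var [] = 0"
  by (simp add: Var_def)

text \<open>The entry may be inserted at, or removed from, any position of the vector.\<close>

definition adds_entry :: "real list \<Rightarrow> real list \<Rightarrow> bool" where
  "adds_entry D D' \<longleftrightarrow> (\<exists>xs x ys. D = xs @ ys \<and> D' = xs @ x # ys)"

definition neighbors :: "real list \<Rightarrow> real list \<Rightarrow> bool" where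
  "neighbors D D' \<longleftrightarrow> adds_entry D D' \<or> adds_entry D' D"

definition has_sensitivity :: "(real list \<Rightarrow> real) \<Rightarrow> real \<Rightarrow> bool" where
  "has_sensitivity g \<Delta> \<longleftrightarrow> (\<forall>D D'. neighbors D D' \<longrightarrow> \<bar>g D - g D'\<bar> \<le> \<Delta>)"

section \<open>Real-RAM programs and their running time\<close>

text \<open>
  Algorithms on real vectors are programs of a unit-cost real RAM, presented as a structured
  while-language.  The memory consists of arrays of natural numbers and arrays of real numbers.
  The name of an array is a literal of the program, so a program uses only finitely many arrays;
  the index is computed, which gives indirect addressing.  A scalar variable is an array used only
  at index 0.  Real numbers are accessible only through field operations and comparisons (there is
  no rounding to integers), natural numbers through addition, truncated subtraction and
  comparisons.  As in the Blum-Shub-Smale model, a program may contain fixed real constants.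
  Dividing by zero yields 0.
\<close>

record store =
  nats :: "nat \<Rightarrow> nat \<Rightarrow> nat"
  reals :: "nat \<Rightarrow> nat \<Rightarrow> real"

datatype nexp =
    NConst nat
  | NCell nat nexp
  | NPlus nexp nexp
  | NMinus nexp nexp

datatype rexp =
    RConst real
  | RCell nat nexp
  | RPlus rexp rexp
  | RMinus rexp rexp
  | RTimes rexp rexp
  | RDivide rexp rexp

datatype bexp =
    NLess nexp nexp
  | RLess rexp rexp
  | BNot bexp
  | BAnd bexp bexp

datatype com =
    Skip
  | NAssign nat nexp nexp
  | RAssign nat nexp rexp
  | Seq com com
  | If bexp com com
  | While bexp com

fun nval :: "nexp \<Rightarrow> store \<Rightarrow> nat" where
  "nval (NConst k) s = k"
| "nval (NCell a i) s = nats s a (nval i s)"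
| "nval (NPlus e f) s = nval e s + nval f s"
| "nval (NMinus e f) s = nval e s - nval f s"

fun rval :: "rexp \<Rightarrow> store \<Rightarrow> real" where
  "rval (RConst c) s = c"
| "rval (RCell a i) s = reals s a (nval i s)"
| "rval (RPlus e f) s = rval e s + rval f s"
| "rval (RMinus e f) s = rval e s - rval f s"
| "rval (RTimes e f) s = rval e s * rval f s"
| "rval (RDivide e f) s = rval e s / rval f s"

fun bval :: "bexp \<Rightarrow> store \<Rightarrow> bool" where
  "bval (NLess e f) s = (nval e s < nval f s)"
| "bval (RLess e f) s = (rval e s < rval f s)"
| "bval (BNot b) s = (\<not> bval b s)"
| "bval (BAnd b c) s = (bval b s \<and> bval c s)"

text \<open>Evaluating an expression costs one unit for each of its nodes.\<close>

fun ncost :: "nexp \<Rightarrow> nat" where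
  "ncost (NConst k) = 1"
| "ncost (NCell a i) = 1 + ncost i"
| "ncost (NPlus e f) = 1 + ncost e + ncost f"
| "ncost (NMinus e f) = 1 + ncost e + ncost f"

fun rcost :: "rexp \<Rightarrow> nat" where
  "rcost (RConst c) = 1"
| "rcost (RCell a i) = 1 + ncost i"
| "rcost (RPlus e f) = 1 + rcost e + rcost f"
| "rcost (RMinus e f) = 1 + rcost e + rcost f"
| "rcost (RTimes e f) = 1 + rcost e + rcost f"
| "rcost (RDivide e f) = 1 + rcost e + rcost f"

fun bcost :: "bexp \<Rightarrow> nat" where
  "bcost (NLess e f) = 1 + ncost e + ncost f"
| "bcost (RLess e f) = 1 + rcost e + rcost f"
| "bcost (BNot b) = 1 + bcost b"
| "bcost (BAnd b c) = 1 + bcost b + bcost c"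

definition write_nat :: "nat \<Rightarrow> nat \<Rightarrow> nat \<Rightarrow> store \<Rightarrow> store" where
  "write_nat a i k s = s\<lparr>nats := (nats s)(a := (nats s a)(i := k))\<rparr>"

definition write_real :: "nat \<Rightarrow> nat \<Rightarrow> real \<Rightarrow> store \<Rightarrow> store" where
  "write_real a i x s = s\<lparr>reals := (reals s)(a := (reals s a)(i := x))\<rparr>"

text \<open>
  \<open>runs c s t s'\<close>: started in store \<open>s\<close>, the program \<open>c\<close> terminates in store \<open>s'\<close>
  after exactly \<open>t\<close> units of time.
\<close>

inductive runs :: "com \<Rightarrow> store \<Rightarrow> nat \<Rightarrow> store \<Rightarrow> bool" where
  Skip: "runs Skip s 1 s"
| NAssign: "runs (NAssign a i e) s (1 + ncost i + ncost e) (write_nat a (nval i s) (nval e s) s)"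
| RAssign: "runs (RAssign a i e) s (1 + ncost i + rcost e) (write_real a (nval i s) (rval e s) s)"
| Seq: "runs c s t s' \<Longrightarrow> runs d s' u s'' \<Longrightarrow> runs (Seq c d) s (t + u) s''"
| IfTrue: "bval b s \<Longrightarrow> runs c s t s' \<Longrightarrow> runs (If b c d) s (1 + bcost b + t) s'"
| IfFalse: "\<not> bval b s \<Longrightarrow> runs d s t s' \<Longrightarrow> runs (If b c d) s (1 + bcost b + t) s'"
| WhileFalse: "\<not> bval b s \<Longrightarrow> runs (While b c) s (1 + bcost b) s"
| WhileTrue: "bval b s \<Longrightarrow> runs c s t s' \<Longrightarrow> runs (While b c) s' u s'' \<Longrightarrow>
    runs (While b c) s (1 + bcost b + t + u) s''"

lemma runs_deterministic:
  assumes "runs c s t s'" and "runs c s u s''"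
  shows "u = t \<and> s'' = s'"
  using assms
proof (induction arbitrary: u s'' rule: runs.induct)
  case (Skip s)
  then show ?case by cases simp
next
  case (NAssign a i e s)
  then show ?case by cases simp
next
  case (RAssign a i e s)
  then show ?case by cases simp
next
  case (Seq c s t s' d v sa)
  from Seq.prems show ?case
    by cases (use Seq.IH in blast)
next
  case (IfTrue b s c t s' d)
  from IfTrue.prems show ?case
    by cases (use IfTrue.IH IfTrue.hyps in blast)+
next
  case (IfFalse b s d t s' c)
  from IfFalse.prems show ?case
    by cases (use IfFalse.IH IfFalse.hyps in blast)+
next
  case (WhileFalse b s c)
  from WhileFalse.prems show ?case
    by cases (use WhileFalse.hyps in blast)+
next
  case (WhileTrue b s c t s' v sa)
  from WhileTrue.prems show ?case
    by cases (use WhileTrue.IH WhileTrue.hyps in blast)+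
qed

text \<open>
  Input: the entries are in cells \<open>0, \<dots>, n - 1\<close> of real array 0 and \<open>n\<close> is in cell 0 of
  natural-number array 0; every other cell holds 0.  Output: cell 0 of real array 0.
\<close>

definition input_store :: "real list \<Rightarrow> store" where
  "input_store D =
     \<lparr>nats = (\<lambda>a i. if a = 0 \<and> i = 0 then length D else 0),
      reals = (\<lambda>a i. if a = 0 \<and> i < length D then D ! i else 0)\<rparr>"

definition computes_within :: "com \<Rightarrow> (real list \<Rightarrow> real) \<Rightarrow> (nat \<Rightarrow> nat) \<Rightarrow> bool" where
  "computes_within c g T \<longleftrightarrow>
     (\<forall>D. \<exists>t s. runs c (input_store D) t s \<and> reals s 0 0 = g D \<and> t \<le> T (length D))"

end

theory Submission
  imports Defs
begin

text \<open>
  Since \<open>n\<^sup>2 Var D\<close> is the sum of the squared differences over all pairs of entries, think of the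
  entries as vertices of a complete graph whose edges carry the demands \<open>(x\<^sub>i - x\<^sub>j)\<^sup>2\<close>.  Give every
  vertex the budget \<open>n\<^sup>2 \<Delta> / 4\<close> and serve the edges greedily in lexicographic order, charging
  the amount served to both endpoints; \<open>g D\<close> is the total amount served, divided by \<open>n\<^sup>2\<close>.
  One greedy step is nonexpansive in the \<open>\<ell>\<^sup>1\<close>-norm of the vector of remaining budgets, so the total
  is a Lipschitz function of the initial budgets.  A new entry amounts to raising one budget from
  zero and the others from \<open>n\<^sup>2 \<Delta> / 4\<close> to \<open>(n + 1)\<^sup>2 \<Delta> / 4\<close>, which gives the sensitivity.  An edge
  that is not fully served has an endpoint with exhausted budget, which gives the error bound.
\<close>

section \<open>Greedy service of demands\<close>

text \<open>An edge \<open>(i, j, c)\<close> has endpoints \<open>i\<close>, \<open>j\<close> and demand \<open>c\<close>; \<open>r\<close> holds the remaining budgets.\<close>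

definition served :: "nat \<times> nat \<times> real \<Rightarrow> (nat \<Rightarrow> real) \<Rightarrow> real" where
  "served e r = (case e of (i, j, c) \<Rightarrow> min c (min (r i) (r j)))"

definition charge :: "nat \<times> nat \<times> real \<Rightarrow> (nat \<Rightarrow> real) \<Rightarrow> nat \<Rightarrow> real" where
  "charge e r = (case e of (i, j, c) \<Rightarrow> r(i := r i - served e r, j := r j - served e r))"

fun greedy :: "(nat \<times> nat \<times> real) list \<Rightarrow> (nat \<Rightarrow> real) \<Rightarrow> real" where
  "greedy [] r = 0"
| "greedy (e # es) r = served e r + greedy es (charge e r)"

text \<open>Loops are excluded because \<open>charge\<close> would debit a loop only once.\<close>

definition edge_on :: "nat set \<Rightarrow> nat \<times> nat \<times> real \<Rightarrow> bool" where
  "edge_on V e = (case e of (i, j, c) \<Rightarrow> i \<in> V \<and> j \<in> V \<and> i \<noteq> j \<and> 0 \<le> c)"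

text \<open>The weighted degree of the vertex \<open>k\<close>.\<close>

definition demand :: "nat \<Rightarrow> (nat \<times> nat \<times> real) list \<Rightarrow> real" where
  "demand k es = (\<Sum>(i, j, c)\<leftarrow>es. if i = k \<or> j = k then c else 0)"

section \<open>Nonexpansiveness of greedy service\<close>

lemma sum_remove2:
  fixes f :: "'a \<Rightarrow> 'b::comm_monoid_add"
  assumes "finite V" "i \<in> V" "j \<in> V" "i \<noteq> j"
  shows "sum f V = f i + (f j + sum f (V - {i, j}))"
proof -
  have "sum f V = f i + sum f (V - {i})"
    using assms by (simp add: sum.remove)
  also have "sum f (V - {i}) = f j + sum f (V - {i} - {j})"
    using assms by (intro sum.remove) auto
  also have "V - {i} - {j} = V - {i, j}" by auto
  finally show ?thesis .
qed

lemma served_nonneg: "edge_on V e \<Longrightarrow> \<forall>k. 0 \<le> r k \<Longrightarrow> 0 \<le> served e r"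
  by (cases e) (auto simp: edge_on_def served_def)

lemma charge_nonneg: "\<forall>k. 0 \<le> r k \<Longrightarrow> 0 \<le> charge e r k"
  by (cases e) (auto simp: charge_def served_def)

lemma charge_other: "e = (i, j, c) \<Longrightarrow> k \<notin> {i, j} \<Longrightarrow> charge e r k = r k"
  by (simp add: charge_def)

lemma sum_charge:
  assumes "finite V" "edge_on V e"
  shows "sum (charge e r) V = sum r V - 2 * served e r"
proof -
  obtain i j c where e: "e = (i, j, c)" by (cases e)
  have *: "i \<in> V" "j \<in> V" "i \<noteq> j" using assms(2) by (auto simp: e edge_on_def)
  have "sum (charge e r) (V - {i, j}) = sum r (V - {i, j})"
    by (rule sum.cong) (auto simp: charge_other[OF e])
  then show ?thesis
    using * by (simp add: sum_remove2[OF assms(1) *] charge_def e)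
qed

text \<open>The plane splits into three regions according to which argument attains the minimum.
  There \<open>(a, b)\<close> goes to \<open>(a - c, b - c)\<close>, \<open>(0, b - a)\<close> or
  \<open>(a - b, 0)\<close>, and each of these maps is nonexpansive in the l1-norm. The proof checks
  all nine pairs of regions.\<close>

lemma min_subtract_nonexpansive:
  fixes a b a' b' c :: real
  defines "w \<equiv> min c (min a b)" and "w' \<equiv> min c (min a' b')"
  shows "\<bar>(a - w) - (a' - w')\<bar> + \<bar>(b - w) - (b' - w')\<bar> \<le> \<bar>a - a'\<bar> + \<bar>b - b'\<bar>"
proof -
  have "w = c \<and> c \<le> a \<and> c \<le> b \<or> w = a \<and> a \<le> c \<and> a \<le> b \<or> w = b \<and> b \<le> c \<and> b \<le> a"
    "w' = c \<and> c \<le> a' \<and> c \<le> b' \<or> w' = a' \<and> a' \<le> c \<and> a' \<le> b' \<or> w' = b' \<and> b' \<le> c \<and> b' \<le> a'"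
    unfolding w_def w'_def by linarith+
  then show ?thesis by (elim disjE conjE; simp; linarith)
qed

lemma charge_nonexpansive:
  assumes "finite V" "edge_on V e"
  shows "(\<Sum>k\<in>V. \<bar>charge e r k - charge e r' k\<bar>) \<le> (\<Sum>k\<in>V. \<bar>r k - r' k\<bar>)"
proof -
  obtain i j c where e: "e = (i, j, c)" by (cases e)
  have *: "i \<in> V" "j \<in> V" "i \<noteq> j" using assms(2) by (auto simp: e edge_on_def)
  have "(\<Sum>k\<in>V - {i, j}. \<bar>charge e r k - charge e r' k\<bar>) = (\<Sum>k\<in>V - {i, j}. \<bar>r k - r' k\<bar>)"
    by (rule sum.cong) (auto simp: charge_other[OF e])
  then show ?thesis
    using * min_subtract_nonexpansive[of "r i" c "r j" "r' i" "r' j"]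
    by (simp add: sum_remove2[OF assms(1) *] charge_def served_def e)
qed

text \<open>
  Serving \<open>w\<close> on an edge lowers the sum of the budgets by \<open>2 w\<close>, so the left-hand side is the
  difference of the sums of the final budgets.  Bounding the difference of the totals served
  directly would not go through by induction.
\<close>

lemma greedy_conservation:
  assumes "finite V" "\<forall>e\<in>set es. edge_on V e"
  shows "\<bar>2 * (greedy es r - greedy es r') - (\<Sum>k\<in>V. r k - r' k)\<bar> \<le> (\<Sum>k\<in>V. \<bar>r k - r' k\<bar>)"
  using assms(2)
proof (induction es arbitrary: r r')
  case Nil
  then show ?case using sum_abs[of "\<lambda>k. r k - r' k" V] by (simp only: greedy.simps) simp
next
  case (Cons e es)
  then have e: "edge_on V e" by simp
  have "2 * (greedy (e # es) r - greedy (e # es) r') - (\<Sum>k\<in>V. r k - r' k)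
      = 2 * (greedy es (charge e r) - greedy es (charge e r')) - (\<Sum>k\<in>V. charge e r k - charge e r' k)"
    by (simp add: sum_subtractf sum_charge[OF assms(1) e])
  also have "\<bar>\<dots>\<bar> \<le> (\<Sum>k\<in>V. \<bar>charge e r k - charge e r' k\<bar>)"
    using Cons by simp
  also have "\<dots> \<le> (\<Sum>k\<in>V. \<bar>r k - r' k\<bar>)"
    by (rule charge_nonexpansive[OF assms(1) e])
  finally show ?case .
qed

text \<open>Conservation puts twice the difference of the totals within the l1-distance of a number
  that is itself bounded by that distance, so the factor 2 cancels.\<close>

lemma greedy_lipschitz:
  assumes "finite V" "\<forall>e\<in>set es. edge_on V e"
  shows "\<bar>greedy es r - greedy es r'\<bar> \<le> (\<Sum>k\<in>V. \<bar>r k - r' k\<bar>)"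
proof -
  have "\<bar>\<Sum>k\<in>V. r k - r' k\<bar> \<le> (\<Sum>k\<in>V. \<bar>r k - r' k\<bar>)" by (rule sum_abs)
  with greedy_conservation[OF assms, of r r'] show ?thesis
    by (simp add: abs_le_iff algebra_simps)
qed

section \<open>Bounds for the amount served\<close>

lemma greedy_nonneg:
  assumes "\<forall>e\<in>set es. edge_on V e" "\<forall>k. 0 \<le> r k"
  shows "0 \<le> greedy es r"
  using assms by (induction es arbitrary: r) (auto simp: charge_nonneg intro!: add_nonneg_nonneg served_nonneg)

text \<open>Every unit served is debited at two endpoints, and no budget drops below zero.\<close>

lemma greedy_le_budget:
  assumes "finite V" "\<forall>e\<in>set es. edge_on V e" "\<forall>k. 0 \<le> r k"
  shows "2 * greedy es r \<le> sum r V"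
  using assms(2,3)
proof (induction es arbitrary: r)
  case Nil
  then show ?case by (simp add: sum_nonneg)
next
  case (Cons e es)
  then have "2 * greedy es (charge e r) \<le> sum (charge e r) V"
    by (simp add: charge_nonneg)
  then show ?case using Cons.prems by (simp add: sum_charge[OF assms(1)])
qed

lemma greedy_le_total_demand: "greedy es r \<le> (\<Sum>(i, j, c)\<leftarrow>es. c)"
proof (induction es arbitrary: r)
  case (Cons e es)
  have "served e r \<le> (case e of (i, j, c) \<Rightarrow> c)" by (cases e) (simp add: served_def)
  then show ?case using Cons[of "charge e r"] by simp
qed simp

lemma demand_nonneg: "\<forall>e\<in>set es. edge_on V e \<Longrightarrow> 0 \<le> demand k es"
  unfolding demand_def by (intro sum_list_nonneg) (auto simp: edge_on_def)

text \<open>Call the outstanding demand of a vertex beyond its remaining budget its excess. An edge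
  that is not fully served exhausts an endpoint, whose excess falls by exactly the unserved part; so
  the initial excesses pay for the whole loss.\<close>

lemma greedy_loss:
  assumes "finite V" "\<forall>e\<in>set es. edge_on V e" "\<forall>k. 0 \<le> r k"
  shows "(\<Sum>(i, j, c)\<leftarrow>es. c) - greedy es r \<le> (\<Sum>k\<in>V. max (demand k es - r k) 0)"
  using assms(2,3)
proof (induction es arbitrary: r)
  case Nil
  then show ?case by (simp add: sum_nonneg)
next
  case (Cons e es)
  obtain i j c where e: "e = (i, j, c)" by (cases e)
  have *: "i \<in> V" "j \<in> V" "i \<noteq> j" "0 \<le> c" using Cons.prems(1) by (auto simp: e edge_on_def)
  define w where "w = served e r"
  have w: "w = min c (min (r i) (r j))" by (simp add: w_def served_def e)
  have dem: "demand k (e # es) = (if k = i \<or> k = j then c else 0) + demand k es" for k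
    by (auto simp: demand_def e)
  have nn: "0 \<le> demand k es" for k using Cons.prems(1) by (intro demand_nonneg) auto
  have r: "0 \<le> r i" "0 \<le> r j" using Cons.prems(2) by auto
  have IH: "(\<Sum>(i, j, c)\<leftarrow>es. c) - greedy es (charge e r)
      \<le> (\<Sum>k\<in>V. max (demand k es - charge e r k) 0)"
    using Cons by (simp add: charge_nonneg)
  have rest: "(\<Sum>k\<in>V - {i, j}. max (demand k es - charge e r k) 0)
      = (\<Sum>k\<in>V - {i, j}. max (demand k (e # es) - r k) 0)"
    by (rule sum.cong) (auto simp: charge_other[OF e] dem)
  \<comment> \<open>For \<open>w = c\<close> both excesses stay the same. For \<open>w = r i\<close>
    the excess at \<open>i\<close> becomes \<open>demand i es\<close>, a drop of
    \<open>c - w\<close>, and the one at \<open>j\<close> does not grow because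
    \<open>w \<le> c\<close>; \<open>w = r j\<close> is symmetric.\<close>
  have "c - w + max (demand i es - (r i - w)) 0 + max (demand j es - (r j - w)) 0
      \<le> max (c + demand i es - r i) 0 + max (c + demand j es - r j) 0"
  proof -
    have "w = c \<or> w = r i \<and> w \<le> c \<and> w \<le> r j \<or> w = r j \<and> w \<le> c \<and> w \<le> r i"
      unfolding w by linarith
    then show ?thesis
    proof (elim disjE conjE)
      assume "w = c"
      then show ?thesis by (simp add: algebra_simps)
    next
      assume "w = r i" "w \<le> c" "w \<le> r j"
      then show ?thesis using nn[of i] by linarith
    next
      assume "w = r j" "w \<le> c" "w \<le> r i"
      then show ?thesis using nn[of j] by linarith
    qed
  qed
  then have "c - w + (\<Sum>k\<in>V. max (demand k es - charge e r k) 0)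
      \<le> (\<Sum>k\<in>V. max (demand k (e # es) - r k) 0)"
    using * rest by (simp add: sum_remove2[OF assms(1) *(1,2,3)] dem) (simp add: charge_def e w_def)
  then show ?case using IH by (simp add: e w_def)
qed

section \<open>Deleting and renaming vertices\<close>

text \<open>A zero budget stays zero and blocks all edges at its vertex. An absent entry can
  therefore be modelled as a vertex with budget zero.\<close>

lemma greedy_filter_zero:
  assumes "\<forall>e\<in>set es. edge_on V e" "\<forall>k. 0 \<le> r k" "r v = 0"
  shows "greedy (filter (\<lambda>(i, j, c). i \<noteq> v \<and> j \<noteq> v) es) r = greedy es r"
  using assms
proof (induction es arbitrary: r)
  case (Cons e es)
  obtain i j c where e: "e = (i, j, c)" by (cases e)
  have *: "0 \<le> c" using Cons.prems(1) by (auto simp: e edge_on_def)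
  show ?case
  proof (cases "i \<noteq> v \<and> j \<noteq> v")
    case True
    then have "charge e r v = 0" using Cons.prems(3) by (simp add: charge_def e)
    then show ?thesis using Cons True by (simp add: e charge_nonneg)
  next
    case False
    then have "served e r = 0" using * Cons.prems(2,3) by (auto simp: served_def e min_absorb1 min_absorb2)
    moreover from this have "charge e r = r" by (simp add: charge_def e)
    ultimately show ?thesis using Cons False by (simp add: e)
  qed
qed simp

lemma greedy_relabel:
  assumes "inj \<sigma>"
  shows "greedy (map (\<lambda>(i, j, c). (\<sigma> i, \<sigma> j, c)) es) r = greedy es (r \<circ> \<sigma>)"
proof (induction es arbitrary: r)
  case (Cons e es)
  obtain i j c where e: "e = (i, j, c)" by (cases e)
  have "charge (\<sigma> i, \<sigma> j, c) r \<circ> \<sigma> = charge e (r \<circ> \<sigma>)"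
    using assms by (auto simp: charge_def served_def e fun_eq_iff inj_eq)
  then show ?case using Cons by (simp add: e served_def flip: comp_assoc) (simp add: comp_def)
qed simp

section \<open>The squared differences of a database\<close>

definition sqdiff :: "real list \<Rightarrow> nat \<Rightarrow> nat \<Rightarrow> nat \<times> nat \<times> real" where
  "sqdiff D i j = (i, j, (D ! i - D ! j)\<^sup>2)"

text \<open>The start row \<open>m\<close> serves the loop invariant: these are the edges left when
  the row counter of the program is \<open>m\<close>.\<close>

definition sqdiffs_from :: "real list \<Rightarrow> nat \<Rightarrow> (nat \<times> nat \<times> real) list" where
  "sqdiffs_from D m = concat (map (\<lambda>i. map (sqdiff D i) [Suc i..<length D]) [m..<length D])"

abbreviation sqdiffs :: "real list \<Rightarrow> (nat \<times> nat \<times> real) list" where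
  "sqdiffs D \<equiv> sqdiffs_from D 0"

definition clipped_Var :: "real \<Rightarrow> real list \<Rightarrow> real" where
  "clipped_Var \<Delta> D =
     greedy (sqdiffs D) (\<lambda>_. \<Delta> / 4 * (real (length D))\<^sup>2) / (real (length D))\<^sup>2"

lemma edge_on_sqdiffs: "\<forall>e\<in>set (sqdiffs D). edge_on {..<length D} e"
  by (auto simp: sqdiffs_from_def sqdiff_def edge_on_def)

lemma sum_list_sqdiffs:
  "(\<Sum>e\<leftarrow>sqdiffs D. f e :: real) = (\<Sum>i<length D. \<Sum>j=Suc i..<length D. f (sqdiff D i j))"
proof -
  have "sum_list (concat xss) = sum_list (map sum_list xss)" for xss :: "real list list"
    by (induction xss) auto
  then show ?thesis
    by (simp add: sqdiffs_from_def map_concat comp_def interv_sum_list_conv_sum_set_nat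
        atLeast0LessThan)
qed

lemma sum_symmetric_pairs:
  fixes f :: "nat \<Rightarrow> nat \<Rightarrow> real"
  assumes "\<And>i j. f i j = f j i" "\<And>i. f i i = 0"
  shows "(\<Sum>i<n. \<Sum>j<n. f i j) = 2 * (\<Sum>i<n. \<Sum>j=Suc i..<n. f i j)"
proof (induction n)
  case (Suc n)
  have "(\<Sum>i<Suc n. \<Sum>j<Suc n. f i j) = (\<Sum>i<n. \<Sum>j<n. f i j) + 2 * (\<Sum>i<n. f i n)"
    by (simp add: sum.distrib assms(2) assms(1)[of n])
  moreover have "(\<Sum>i<Suc n. \<Sum>j=Suc i..<Suc n. f i j)
      = (\<Sum>i<n. (\<Sum>j=Suc i..<n. f i j) + f i n)"
    by (auto intro!: sum.cong)
  ultimately show ?case using Suc by (simp add: sum.distrib)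
qed simp

lemma demand_sqdiffs:
  assumes "k < length D"
  shows "demand k (sqdiffs D) = (\<Sum>j<length D. (D ! k - D ! j)\<^sup>2)"
proof -
  let ?n = "length D" and ?c = "\<lambda>i j. (D ! i - D ! j)\<^sup>2"
  let ?f = "\<lambda>i j. if i = k \<or> j = k then ?c i j else 0"
  have "2 * demand k (sqdiffs D) = 2 * (\<Sum>i<?n. \<Sum>j=Suc i..<?n. ?f i j)"
    by (simp add: demand_def sum_list_sqdiffs sqdiff_def)
  also have "\<dots> = (\<Sum>i<?n. \<Sum>j<?n. ?f i j)"
    by (rule sum_symmetric_pairs[symmetric]) (auto simp: power2_commute)
  \<comment> \<open>The two cases overlap only at \<open>i = j = k\<close>, where the square is
    0.\<close>
  also have "\<dots> = (\<Sum>i<?n. \<Sum>j<?n. (if i = k then ?c k j else 0) + (if j = k then ?c i k else 0))"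
    by (intro sum.cong) auto
  also have "\<dots> = (\<Sum>j<?n. ?c k j) + (\<Sum>i<?n. ?c i k)"
  proof -
    have "(\<Sum>i<?n. \<Sum>j<?n. if i = k then ?c k j else 0) = (\<Sum>j<?n. ?c k j)"
      using assms by (subst sum.swap) simp
    then show ?thesis using assms by (simp add: sum.distrib)
  qed
  also have "\<dots> = 2 * (\<Sum>j<?n. ?c k j)"
    by (simp add: power2_commute)
  finally show ?thesis by simp
qed

text \<open>The pairwise formula for the variance: both sides equal
  \<open>real ?n * ?q - ?s\<^sup>2\<close>.\<close>

lemma total_sqdiffs: "(\<Sum>(i, j, c)\<leftarrow>sqdiffs D. c) = (real (length D))\<^sup>2 * Var D"
proof (cases "D = []")
  case True
  then show ?thesis by (simp add: sqdiffs_from_def)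
next
  case False
  let ?n = "length D" and ?s = "\<Sum>i<length D. D ! i" and ?q = "\<Sum>i<length D. (D ! i)\<^sup>2"
  have n: "real ?n > 0" using False by simp
  have "2 * (\<Sum>(i, j, c)\<leftarrow>sqdiffs D. c) = 2 * (\<Sum>i<?n. \<Sum>j=Suc i..<?n. (D ! i - D ! j)\<^sup>2)"
    by (simp add: sum_list_sqdiffs sqdiff_def)
  also have "\<dots> = (\<Sum>i<?n. \<Sum>j<?n. (D ! i - D ! j)\<^sup>2)"
    by (rule sum_symmetric_pairs[symmetric]) (auto simp: power2_commute)
  also have "\<dots> = (\<Sum>i<?n. \<Sum>j<?n. (D ! i)\<^sup>2) + (\<Sum>i<?n. \<Sum>j<?n. (D ! j)\<^sup>2)
      - 2 * (\<Sum>i<?n. \<Sum>j<?n. D ! i * D ! j)"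
    by (simp add: power2_diff sum.distrib sum_subtractf sum_distrib_left mult.assoc)
  also have "(\<Sum>i<?n. \<Sum>j<?n. (D ! i)\<^sup>2) = real ?n * ?q"
    by (simp add: sum_distrib_left)
  also have "(\<Sum>i<?n. \<Sum>j<?n. (D ! j)\<^sup>2) = real ?n * ?q"
    by simp
  also have "(\<Sum>i<?n. \<Sum>j<?n. D ! i * D ! j) = ?s\<^sup>2"
    by (simp only: power2_eq_square sum_product)
  finally have 1: "(\<Sum>(i, j, c)\<leftarrow>sqdiffs D. c) = real ?n * ?q - ?s\<^sup>2" by simp
  have mean: "mean D = ?s / real ?n"
    by (simp add: mean_def sum_list_sum_nth atLeast0LessThan)
  have "Var D * real ?n = (\<Sum>i<?n. (D ! i - mean D)\<^sup>2)"
    using n by (simp add: Var_def sum_list_sum_nth atLeast0LessThan)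
  also have "\<dots> = ?q + real ?n * (mean D)\<^sup>2 - 2 * ?s * mean D"
    by (simp add: power2_diff sum.distrib sum_subtractf sum_distrib_left sum_distrib_right)
  also have "\<dots> = ?q - ?s\<^sup>2 / real ?n"
    using n by (simp add: mean power2_eq_square field_simps)
  finally have "real ?n * (Var D * real ?n) = real ?n * ?q - ?s\<^sup>2"
    using n by (simp add: field_simps)
  then show ?thesis by (simp add: 1 power2_eq_square mult_ac)
qed

section \<open>Insertion of an entry into the list of pairs\<close>

text \<open>\<open>\<sigma>\<close> is the increasing enumeration of the indices other than
  \<open>p\<close>. The induction starts at \<open>n = p\<close> because \<open>\<sigma>\<close> is
  the identity below \<open>p\<close>.\<close>

lemma filter_upt_skip:
  fixes p :: nat
  defines "\<sigma> \<equiv> \<lambda>k. if k < p then k else Suc k"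
  assumes "p \<le> n"
  shows "filter (\<lambda>k. k \<noteq> p) [\<sigma> m..<Suc n] = map \<sigma> [m..<n]"
  using \<open>p \<le> n\<close>
proof (induction n rule: dec_induct)
  case base
  have "filter (\<lambda>k. k \<noteq> p) [m..<p] = [m..<p]" by (auto simp: filter_id_conv)
  moreover have "map \<sigma> [m..<p] = [m..<p]" by (auto simp: \<sigma>_def intro: map_idI)
  ultimately show ?case by (simp add: \<sigma>_def)
next
  case (step n)
  then show ?case by (auto simp: \<sigma>_def)
qed

text \<open>The starting points \<open>Suc (\<sigma> m)\<close> and \<open>\<sigma> (Suc m)\<close>
  differ only for \<open>Suc m = p\<close>; then the interval has the additional head
  \<open>p\<close>, which the filter drops.\<close>

lemma filter_upt_skip_Suc:
  fixes p :: nat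
  defines "\<sigma> \<equiv> \<lambda>k. if k < p then k else Suc k"
  assumes "p \<le> n"
  shows "filter (\<lambda>k. k \<noteq> p) [Suc (\<sigma> m)..<Suc n] = map \<sigma> [Suc m..<n]"
proof (cases "Suc m = p")
  case True
  then have "[Suc (\<sigma> m)..<Suc n] = p # [\<sigma> (Suc m)..<Suc n]"
    using assms(2) by (simp add: \<sigma>_def upt_rec[of p])
  then show ?thesis using filter_upt_skip[OF assms(2), of "Suc m"] by (simp add: \<sigma>_def)
next
  case False
  then have "Suc (\<sigma> m) = \<sigma> (Suc m)" by (auto simp: \<sigma>_def)
  then show ?thesis using filter_upt_skip[OF assms(2), of "Suc m"] by (simp add: \<sigma>_def)
qed

lemma concat_map_filter:
  assumes "\<And>x. x \<in> set xs \<Longrightarrow> \<not> P x \<Longrightarrow> f x = []"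
  shows "concat (map f xs) = concat (map f (filter P xs))"
  using assms by (induction xs) auto

text \<open>Greedy service depends on the order of the edges. As \<open>\<sigma>\<close> is
  increasing, removing the edges at the new vertex leaves the remaining ones in their old
  lexicographic order.\<close>

lemma sqdiffs_insert:
  fixes xs ys :: "real list"
  defines "p \<equiv> length xs"
  defines "\<sigma> \<equiv> \<lambda>k. if k < p then k else Suc k"
  shows "filter (\<lambda>(i, j, c). i \<noteq> p \<and> j \<noteq> p) (sqdiffs (xs @ x # ys))
       = map (\<lambda>(i, j, c). (\<sigma> i, \<sigma> j, c)) (sqdiffs (xs @ ys))"
proof -
  let ?D' = "xs @ x # ys" and ?D = "xs @ ys" and ?n = "length (xs @ ys)"
  let ?P = "\<lambda>(i, j, c). i \<noteq> p \<and> j \<noteq> p"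
  let ?S = "\<lambda>(i, j, c). (\<sigma> i, \<sigma> j, c)"
  define row where "row i = filter ?P (map (sqdiff ?D' i) [Suc i..<Suc ?n])" for i
  have n: "p \<le> ?n" by (simp add: p_def)
  have nth: "?D' ! \<sigma> k = ?D ! k" for k
    by (auto simp: \<sigma>_def p_def nth_append Suc_diff_le)
  have row_p: "row p = []" by (simp add: row_def filter_empty_conv sqdiff_def)
  have row: "row (\<sigma> i) = map ?S (map (sqdiff ?D i) [Suc i..<?n])" for i
  proof -
    have "\<sigma> i \<noteq> p" by (simp add: \<sigma>_def)
    then have "row (\<sigma> i) = map (sqdiff ?D' (\<sigma> i)) (filter (\<lambda>k. k \<noteq> p) [Suc (\<sigma> i)..<Suc ?n])"
      unfolding row_def by (simp add: filter_map comp_def sqdiff_def)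
    also have "filter (\<lambda>k. k \<noteq> p) [Suc (\<sigma> i)..<Suc ?n] = map \<sigma> [Suc i..<?n]"
      unfolding \<sigma>_def by (rule filter_upt_skip_Suc[OF n])
    also have "map (sqdiff ?D' (\<sigma> i)) (map \<sigma> [Suc i..<?n]) = map ?S (map (sqdiff ?D i) [Suc i..<?n])"
      by (simp add: sqdiff_def nth comp_def)
    finally show ?thesis .
  qed
  \<comment> \<open>For \<open>p = 0\<close> the interval of \<open>filter_upt_skip\<close> starts
    at \<open>\<sigma> 0 = 1\<close>, so the head 0 is split off and dropped by the filter.\<close>
  have up: "filter (\<lambda>k. k \<noteq> p) [0..<Suc ?n] = map \<sigma> [0..<?n]"
    using filter_upt_skip[OF n, of 0] upt_conv_Cons[of 0 "Suc ?n"]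
    by (cases "p = 0") (simp_all add: \<sigma>_def del: upt_Suc)
  have "filter ?P (sqdiffs ?D') = concat (map row [0..<Suc ?n])"
    by (simp add: sqdiffs_from_def filter_concat row_def[abs_def] comp_def del: upt_Suc)
  also have "\<dots> = concat (map row (filter (\<lambda>k. k \<noteq> p) [0..<Suc ?n]))"
    by (rule concat_map_filter) (auto simp: row_p)
  also have "\<dots> = concat (map (\<lambda>i. map ?S (map (sqdiff ?D i) [Suc i..<?n])) [0..<?n])"
    unfolding up by (simp add: row comp_def)
  also have "\<dots> = map ?S (sqdiffs ?D)"
    by (simp add: sqdiffs_from_def map_concat comp_def)
  finally show ?thesis .
qed

section \<open>Sensitivity\<close>

text \<open>With \<open>d = \<Delta> / 4\<close>, the change of the total served contributes at most
  \<open>3 * d\<close> after normalization, and the change of the normalizing factor at most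
  \<open>d\<close>.\<close>

lemma clipped_Var_insert:
  assumes "0 \<le> \<Delta>"
  shows "\<bar>clipped_Var \<Delta> (xs @ x # ys) - clipped_Var \<Delta> (xs @ ys)\<bar> \<le> \<Delta>"
proof -
  define p where "p = length xs"
  define n where "n = length (xs @ ys)"
  define \<sigma> where "\<sigma> = (\<lambda>k. if k < p then k else Suc k)"
  define d where "d = \<Delta> / 4"
  define r where "r = (\<lambda>_::nat. d * (real (Suc n))\<^sup>2)"
  \<comment> \<open>The smaller database seen on the vertices of the larger one: the new vertex
    \<open>p\<close> has budget 0.\<close>
  define r0 where "r0 = (\<lambda>k. if k = p then 0 else d * (real n)\<^sup>2)"
  define G' where "G' = greedy (sqdiffs (xs @ x # ys)) r"
  define G where "G = greedy (sqdiffs (xs @ ys)) (\<lambda>_. d * (real n)\<^sup>2)"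
  have d: "0 \<le> d" using assms by (simp add: d_def)
  have len: "length (xs @ x # ys) = Suc n" by (simp add: n_def)
  have on': "\<forall>e\<in>set (sqdiffs (xs @ x # ys)). edge_on {..<Suc n} e"
    using edge_on_sqdiffs[of "xs @ x # ys"] unfolding len .
  have on: "\<forall>e\<in>set (sqdiffs (xs @ ys)). edge_on {..<n} e"
    using edge_on_sqdiffs[of "xs @ ys"] unfolding n_def .
  have "inj \<sigma>" by (auto simp: \<sigma>_def inj_def split: if_splits)
  have "G = greedy (sqdiffs (xs @ ys)) (r0 \<circ> \<sigma>)"
    unfolding G_def by (rule arg_cong[of _ _ "greedy _"]) (auto simp: r0_def \<sigma>_def)
  also have "\<dots> = greedy (filter (\<lambda>(i, j, c). i \<noteq> p \<and> j \<noteq> p) (sqdiffs (xs @ x # ys))) r0"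
    using greedy_relabel[OF \<open>inj \<sigma>\<close>] sqdiffs_insert[of xs x ys] by (simp add: p_def \<sigma>_def)
  also have "\<dots> = greedy (sqdiffs (xs @ x # ys)) r0"
    using d by (intro greedy_filter_zero[OF on']) (auto simp: r0_def)
  finally have G: "G = greedy (sqdiffs (xs @ x # ys)) r0" .
  have p: "p \<in> {..<Suc n}" by (simp add: p_def n_def)
  have "\<bar>G' - G\<bar> \<le> (\<Sum>k<Suc n. \<bar>r k - r0 k\<bar>)"
    unfolding G G'_def by (rule greedy_lipschitz[OF _ on']) simp
  also have "\<dots> = \<bar>r p - r0 p\<bar> + (\<Sum>k\<in>{..<Suc n} - {p}. \<bar>r k - r0 k\<bar>)"
    using p by (intro sum.remove) auto
  also have "(\<Sum>k\<in>{..<Suc n} - {p}. \<bar>r k - r0 k\<bar>) = (\<Sum>k\<in>{..<Suc n} - {p}. d * (2 * n + 1))"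
    using d by (intro sum.cong) (auto simp: r_def r0_def power2_eq_square algebra_simps)
  also have "\<dots> = n * (d * (2 * n + 1))"
    using p by (simp add: card_Diff_subset)
  also have "\<bar>r p - r0 p\<bar> = d * (real (Suc n))\<^sup>2"
    using d by (simp add: r_def r0_def)
  finally have diff: "\<bar>G' - G\<bar> \<le> d * (real (Suc n))\<^sup>2 + n * (d * (2 * n + 1))" .
  have G0: "0 \<le> G" unfolding G_def using d by (intro greedy_nonneg[OF on]) auto
  have "2 * G \<le> (\<Sum>k<n. d * (real n)\<^sup>2)"
    unfolding G_def using d by (intro greedy_le_budget[OF _ on]) auto
  then have G1: "2 * G \<le> n * (d * (real n)\<^sup>2)" by simp
  \<comment> \<open>For \<open>n = 0\<close> neither database has a pair of entries, so both values
    are 0; otherwise division by the squared length is harmless.\<close>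
  show ?thesis
  proof (cases "n = 0")
    case True
    then have "xs = []" "ys = []" by (auto simp: n_def)
    then show ?thesis using assms by (simp add: clipped_Var_def sqdiffs_from_def)
  next
    case False
    define N where "N = real n"
    have N: "N > 0" using False by (simp add: N_def)
    have "clipped_Var \<Delta> (xs @ x # ys) - clipped_Var \<Delta> (xs @ ys) = G' / (N + 1)\<^sup>2 - G / N\<^sup>2"
      by (simp add: clipped_Var_def G'_def G_def r_def len d_def N_def add.commute[of 1] n_def)
    also have "\<dots> = (G' - G) / (N + 1)\<^sup>2 - G * (2 * N + 1) / (N\<^sup>2 * (N + 1)\<^sup>2)"
    proof -
      have "G' / (N + 1)\<^sup>2 - G / N\<^sup>2 = (G' - G) / (N + 1)\<^sup>2 - (G / N\<^sup>2 - G / (N + 1)\<^sup>2)"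
        by (simp add: diff_divide_distrib)
      also have "G / N\<^sup>2 - G / (N + 1)\<^sup>2 = G * ((N + 1)\<^sup>2 - N\<^sup>2) / (N\<^sup>2 * (N + 1)\<^sup>2)"
        using N by (simp add: diff_frac_eq right_diff_distrib)
      also have "(N + 1)\<^sup>2 - N\<^sup>2 = 2 * N + 1" by (simp add: power2_eq_square algebra_simps)
      finally show ?thesis .
    qed
    also have "\<bar>\<dots>\<bar> \<le> \<bar>G' - G\<bar> / (N + 1)\<^sup>2 + G * (2 * N + 1) / (N\<^sup>2 * (N + 1)\<^sup>2)"
      using N G0 by (intro order.trans[OF abs_triangle_ineq4]) (simp add: abs_mult)
    \<comment> \<open>The first term uses
      \<open>(N + 1)^2 + N * (2 * N + 1) \<le> 3 * (N + 1)^2\<close>. The second uses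
      \<open>2 * G \<le> d * N^3\<close>, the budget bound, and
      \<open>N * (2 * N + 1) \<le> 2 * (N + 1)^2\<close>.\<close>
    also have "\<dots> \<le> 3 * d + d"
    proof (rule add_mono)
      have "\<bar>G' - G\<bar> \<le> d * ((N + 1)\<^sup>2 + N * (2 * N + 1))"
        using diff by (simp add: N_def algebra_simps)
      also have "\<dots> \<le> d * (3 * (N + 1)\<^sup>2)"
        using d N by (intro mult_left_mono) (auto simp: power2_eq_square algebra_simps)
      finally show "\<bar>G' - G\<bar> / (N + 1)\<^sup>2 \<le> 3 * d"
        using N by (simp add: divide_le_eq mult_ac)
      have "2 * (G * (2 * N + 1)) \<le> N * (d * N\<^sup>2) * (2 * N + 1)"
        using G1 N by (simp add: N_def flip: mult.assoc)
      also have "\<dots> = d * N\<^sup>2 * (N * (2 * N + 1))" by (simp add: mult_ac)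
      also have "\<dots> \<le> d * N\<^sup>2 * (2 * (N + 1)\<^sup>2)"
        using d N by (intro mult_left_mono) (auto simp: power2_eq_square algebra_simps)
      finally show "G * (2 * N + 1) / (N\<^sup>2 * (N + 1)\<^sup>2) \<le> d"
        using N by (simp add: divide_le_eq mult_ac) (simp add: algebra_simps)
    qed
    also have "\<dots> = \<Delta>" by (simp add: d_def)
    finally show ?thesis .
  qed
qed

lemma clipped_Var_sensitivity: "0 \<le> \<Delta> \<Longrightarrow> has_sensitivity (clipped_Var \<Delta>) \<Delta>"
  unfolding has_sensitivity_def neighbors_def adds_entry_def
  by (metis abs_minus_commute clipped_Var_insert)

section \<open>Approximation error\<close>

text \<open>The amount served never exceeds the total demand, which is the variance times the
  squared length, so it remains to bound the loss.\<close>

lemma clipped_Var_error: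
  assumes "0 \<le> \<Delta>"
  shows "\<bar>clipped_Var \<Delta> D - Var D\<bar>
    \<le> (\<Sum>i<length D. max ((\<Sum>j<length D. 4 * (D ! i - D ! j)\<^sup>2 / (real (length D))\<^sup>2) - \<Delta>) 0)"
proof (cases "D = []")
  case True
  then show ?thesis by (simp add: clipped_Var_def Var_def)
next
  case False
  define N where "N = (real (length D))\<^sup>2"
  define G where "G = greedy (sqdiffs D) (\<lambda>_. \<Delta> / 4 * N)"
  let ?a = "\<lambda>i. \<Sum>j<length D. (D ! i - D ! j)\<^sup>2"
  have N: "N > 0" using False by (simp add: N_def)
  have "N * Var D - G \<le> (\<Sum>i<length D. max (demand i (sqdiffs D) - \<Delta> / 4 * N) 0)"
    unfolding G_def N_def using assms
    by (subst total_sqdiffs[symmetric]) (intro greedy_loss[OF _ edge_on_sqdiffs], auto)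
  also have "\<dots> = (\<Sum>i<length D. max (?a i - \<Delta> / 4 * N) 0)"
    by (simp add: demand_sqdiffs)
  also have "\<dots> \<le> (\<Sum>i<length D. N * max (4 * ?a i / N - \<Delta>) 0)"
  proof (rule sum_mono)
    fix i
    \<comment> \<open>\<open>greedy_loss\<close> yields a quarter of the claimed bound; the factor 4
      is given away here.\<close>
    have "max (?a i - \<Delta> / 4 * N) 0 \<le> 4 * max (?a i - \<Delta> / 4 * N) 0"
      by (rule order.trans[OF _ mult_right_mono[of 1]]) auto
    also have "\<dots> = max (4 * ?a i - N * \<Delta>) 0" by (simp add: max_def mult.commute)
    also have "\<dots> = N * max (4 * ?a i / N - \<Delta>) 0"
      using N by (simp add: max_mult_distrib_left right_diff_distrib)
    finally show "max (?a i - \<Delta> / 4 * N) 0 \<le> N * max (4 * ?a i / N - \<Delta>) 0" .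
  qed
  finally have "N * (Var D - G / N) \<le> N * (\<Sum>i<length D. max (4 * ?a i / N - \<Delta>) 0)"
    using N by (simp add: right_diff_distrib sum_distrib_left)
  then have 1: "Var D - G / N \<le> (\<Sum>i<length D. max (4 * ?a i / N - \<Delta>) 0)"
    using N by simp
  have "G \<le> N * Var D"
    unfolding G_def N_def total_sqdiffs[symmetric] by (rule greedy_le_total_demand)
  then have "G / N \<le> Var D" using N by (simp add: divide_le_eq mult.commute)
  moreover have "clipped_Var \<Delta> D = G / N" by (simp add: clipped_Var_def G_def N_def)
  ultimately show ?thesis using 1 by (simp add: N_def sum_distrib_left sum_divide_distrib)
qed

section \<open>Computing the clipped variance\<close>

text \<open>The weakest precondition for total correctness, with a postcondition that also sees the
  running time. One run suffices since \<open>runs\<close> is deterministic.\<close>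

definition wp :: "com \<Rightarrow> store \<Rightarrow> (nat \<Rightarrow> store \<Rightarrow> bool) \<Rightarrow> bool" where
  "wp c s Q \<longleftrightarrow> (\<exists>t s'. runs c s t s' \<and> Q t s')"

lemma wp_mono: "wp c s P \<Longrightarrow> (\<And>t s'. P t s' \<Longrightarrow> Q t s') \<Longrightarrow> wp c s Q"
  unfolding wp_def by blast

lemma wp_Skip: "Q 1 s \<Longrightarrow> wp Skip s Q"
  unfolding wp_def using runs.Skip by blast

lemma wp_NAssign:
  "Q (1 + ncost i + ncost e) (write_nat a (nval i s) (nval e s) s) \<Longrightarrow> wp (NAssign a i e) s Q"
  unfolding wp_def using runs.NAssign by blast

lemma wp_RAssign:
  "Q (1 + ncost i + rcost e) (write_real a (nval i s) (rval e s) s) \<Longrightarrow> wp (RAssign a i e) s Q"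
  unfolding wp_def using runs.RAssign by blast

lemma wp_Seq: "wp c s (\<lambda>t s'. wp d s' (\<lambda>u. Q (t + u))) \<Longrightarrow> wp (Seq c d) s Q"
  unfolding wp_def using runs.Seq by blast

lemma wp_If:
  assumes "bval b s \<Longrightarrow> wp c s (\<lambda>t. Q (1 + bcost b + t))"
    and "\<not> bval b s \<Longrightarrow> wp d s (\<lambda>t. Q (1 + bcost b + t))"
  shows "wp (If b c d) s Q"
  using assms unfolding wp_def by (cases "bval b s") (blast intro: runs.IfTrue runs.IfFalse)+

text \<open>\<open>I k\<close> is the invariant after \<open>k\<close> of exactly \<open>m\<close>
  iterations; the guard is evaluated \<open>m + 1\<close> times.\<close>

lemma wp_While:
  assumes "I 0 s"
    and body: "\<And>k s. k < m \<Longrightarrow> I k s \<Longrightarrow> bval b s \<and> wp c s (\<lambda>t s'. t \<le> B \<and> I (Suc k) s')"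
    and exit: "\<And>s. I m s \<Longrightarrow> \<not> bval b s"
    and post: "\<And>t s'. t \<le> m * (1 + bcost b + B) + 1 + bcost b \<Longrightarrow> I m s' \<Longrightarrow> Q t s'"
  shows "wp (While b c) s Q"
proof -
  \<comment> \<open>Generalized to a start after \<open>k\<close> iterations, by induction on the
    number \<open>l\<close> of those still to come.\<close>
  have "wp (While b c) s (\<lambda>t s'. t \<le> l * (1 + bcost b + B) + 1 + bcost b \<and> I m s')"
    if "I k s" "m = k + l" for k l s
    using that
  proof (induction l arbitrary: k s)
    case 0
    then have "I m s" by simp
    then show ?case
      using runs.WhileFalse[OF exit] unfolding wp_def by (intro exI[of _ "1 + bcost b"] exI[of _ s]) auto
  next
    case (Suc l)
    then have b: "bval b s" and "wp c s (\<lambda>t s'. t \<le> B \<and> I (Suc k) s')"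
      using body[of k s] by auto
    then obtain t s' where c: "runs c s t s'" "t \<le> B" "I (Suc k) s'"
      unfolding wp_def by blast
    obtain u s'' where w: "runs (While b c) s' u s''" "u \<le> l * (1 + bcost b + B) + 1 + bcost b" "I m s''"
      using Suc.IH[OF c(3)] Suc.prems(2) unfolding wp_def by auto
    show ?case
      using runs.WhileTrue[OF b c(1) w(1)] c(2) w(2,3) unfolding wp_def by fastforce
  qed
  from this[OF assms(1), of m] show ?thesis
    by (rule wp_mono) (auto intro: post)
qed

lemma write_simps [simp]:
  "nats (write_nat a i k s) = (nats s)(a := (nats s a)(i := k))"
  "reals (write_nat a i k s) = reals s"
  "reals (write_real a i x s) = (reals s)(a := (reals s a)(i := x))"
  "nats (write_real a i x s) = nats s"
  "write_real a i x (write_real a i y s) = write_real a i x s"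
  by (simp_all add: write_nat_def write_real_def)

text \<open>
  Natural-number arrays: 0 holds \<open>n\<close>, 1 the row \<open>i\<close>, 2 the column \<open>j\<close>.  Real arrays: 0 holds the
  input, 1 the budget used up by each vertex, 2 the total served, 3 the number \<open>n\<close> as a real,
  4 the amount served to the current edge, 5 the initial budget.
\<close>

abbreviation nvar :: "nat \<Rightarrow> nexp" where "nvar a \<equiv> NCell a (NConst 0)"
abbreviation rvar :: "nat \<Rightarrow> rexp" where "rvar a \<equiv> RCell a (NConst 0)"

abbreviation incr :: "nat \<Rightarrow> com" where
  "incr a \<equiv> NAssign a (NConst 0) (NPlus (nvar a) (NConst 1))"

text \<open>The machine cannot convert a natural number to a real, so the length is counted up in a
  real cell.\<close>

definition count_com :: com where
  "count_com = While (NLess (nvar 1) (nvar 0))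
     (Seq (RAssign 3 (NConst 0) (RPlus (rvar 3) (RConst 1))) (incr 1))"

definition amount_com :: com where
  "amount_com =
     (let diff = RMinus (RCell 0 (nvar 1)) (RCell 0 (nvar 2));
          left = (\<lambda>a. RMinus (rvar 5) (RCell 1 (nvar a)));
          clip = (\<lambda>a. If (RLess (left a) (rvar 4)) (RAssign 4 (NConst 0) (left a)) Skip)
      in Seq (RAssign 4 (NConst 0) (RTimes diff diff)) (Seq (clip 2) (clip 1)))"

definition serve_com :: com where
  "serve_com =
     Seq amount_com
    (Seq (RAssign 1 (nvar 1) (RPlus (RCell 1 (nvar 1)) (rvar 4)))
    (Seq (RAssign 1 (nvar 2) (RPlus (RCell 1 (nvar 2)) (rvar 4)))
    (Seq (RAssign 2 (NConst 0) (RPlus (rvar 2) (rvar 4)))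
         (incr 2))))"

definition row_com :: com where
  "row_com =
     Seq (NAssign 2 (NConst 0) (NPlus (nvar 1) (NConst 1)))
    (Seq (While (NLess (nvar 2) (nvar 0)) serve_com)
         (incr 1))"

definition clipped_Var_com :: "real \<Rightarrow> com" where
  "clipped_Var_com \<Delta> =
     Seq count_com
    (Seq (RAssign 5 (NConst 0) (RTimes (RConst (\<Delta> / 4)) (RTimes (rvar 3) (rvar 3))))
    (Seq (NAssign 1 (NConst 0) (NConst 0))
    (Seq (While (NLess (nvar 1) (nvar 0)) row_com)
         (RAssign 0 (NConst 0) (RDivide (rvar 2) (RTimes (rvar 3) (rvar 3)))))))"

section \<open>Invariants and time bounds\<close>

definition ready :: "real list \<Rightarrow> real \<Rightarrow> store \<Rightarrow> bool" where
  "ready D \<theta> s \<longleftrightarrow> nats s 0 0 = length D \<and> reals s 0 = reals (input_store D) 0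
     \<and> reals s 3 0 = real (length D) \<and> reals s 5 0 = \<theta>"

text \<open>The invariant of both loops: the total so far plus what greedy service would still yield
  on the edges \<open>es\<close> is the final total. Recording used instead of remaining budgets
  fits a memory that starts at zero.\<close>

definition pending :: "real list \<Rightarrow> real \<Rightarrow> (nat \<times> nat \<times> real) list \<Rightarrow> store \<Rightarrow> bool" where
  "pending D \<theta> es s \<longleftrightarrow> ready D \<theta> s
     \<and> reals s 2 0 + greedy es (\<lambda>k. \<theta> - reals s 1 k) = greedy (sqdiffs D) (\<lambda>_. \<theta>)"

lemma wp_count_com:
  "wp count_com (input_store D)
     (\<lambda>t s. t \<le> 18 * length D + 6 \<and>
        s = (write_real 3 0 (real (length D)) (write_nat 1 0 (length D) (input_store D))))"
  unfolding count_com_def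
proof (rule wp_While[where m = "length D" and B = 12 and
      I = "\<lambda>k s. s = write_real 3 0 (real k) (write_nat 1 0 k (input_store D))"])
  show "input_store D = write_real 3 0 (real 0) (write_nat 1 0 0 (input_store D))"
    by (auto simp: write_nat_def write_real_def input_store_def fun_eq_iff)
next
  fix k s
  assume k: "k < length D" and s: "s = write_real 3 0 (real k) (write_nat 1 0 k (input_store D))"
  show "bval (NLess (nvar 1) (nvar 0)) s \<and>
      wp (Seq (RAssign 3 (NConst 0) (RPlus (rvar 3) (RConst 1))) (incr 1)) s
        (\<lambda>t s'. t \<le> 12 \<and> s' = write_real 3 0 (real (Suc k)) (write_nat 1 0 (Suc k) (input_store D)))"
    using k unfolding s
    by (auto intro!: wp_Seq wp_RAssign wp_NAssign simp: input_store_def write_nat_def write_real_def fun_eq_iff)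
qed (auto simp: input_store_def)

text \<open>Cell 4 is lowered to each remaining budget in turn. The time is 17 for the square and at
  most 18 for each of the two comparisons.\<close>

lemma wp_amount_com:
  assumes "nats s 1 0 = i" "nats s 2 0 = j"
  shows "wp amount_com s (\<lambda>t s'. t \<le> 53 \<and> s' = write_real 4 0
     (min ((reals s 0 i - reals s 0 j)\<^sup>2) (min (reals s 5 0 - reals s 1 i) (reals s 5 0 - reals s 1 j))) s)"
  using assms unfolding amount_com_def Let_def
  by (intro wp_Seq wp_RAssign wp_If wp_Skip) (simp_all add: power2_eq_square min_def)

text \<open>The loop body performs one unfolding of \<open>greedy\<close>. As \<open>i < j\<close>,
  the two writes to array 1 hit different cells and together amount to
  \<open>charge\<close>.\<close>

lemma wp_serve_com:
  assumes "nats s 1 0 = i" "nats s 2 0 = j" "i < j" "j < length D"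
    and "pending D \<theta> (sqdiff D i j # es) s"
  shows "wp serve_com s (\<lambda>t s'. t \<le> 84 \<and> nats s' 1 0 = i \<and> nats s' 2 0 = Suc j \<and> pending D \<theta> es s')"
proof -
  have r: "ready D \<theta> s" using assms(5) by (simp add: pending_def)
  have D: "reals s 0 i = D ! i" "reals s 0 j = D ! j"
    using r assms(3,4) by (simp_all add: ready_def input_store_def)
  have \<theta>: "reals s 5 0 = \<theta>" using r by (simp add: ready_def)
  let ?r = "\<lambda>k. \<theta> - reals s 1 k"
  let ?e = "sqdiff D i j"
  define w where "w = served ?e ?r"
  have w: "w = min ((D ! i - D ! j)\<^sup>2) (min (\<theta> - reals s 1 i) (\<theta> - reals s 1 j))"
    by (simp add: w_def served_def sqdiff_def)
  have charge: "charge ?e ?r = (\<lambda>k. \<theta> - ((reals s 1)(i := reals s 1 i + w, j := reals s 1 j + w)) k)"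
    by (auto simp: charge_def sqdiff_def w_def fun_eq_iff)
  have "served ?e ?r = w" by (simp only: w_def)
  then have served: "reals s 2 0 + (w + greedy es
      (\<lambda>k. \<theta> - ((reals s 1)(i := reals s 1 i + w, j := reals s 1 j + w)) k)) = greedy (sqdiffs D) (\<lambda>_. \<theta>)"
    using assms(5) by (simp only: pending_def greedy.simps charge)
  have amount: "wp amount_com s (\<lambda>t s'. t \<le> 53 \<and> s' = write_real 4 0 w s)"
    using wp_amount_com[OF assms(1,2)] by (simp add: D \<theta> w)
  show ?thesis
    unfolding serve_com_def
  proof (rule wp_Seq, rule wp_mono[OF amount], elim conjE, hypsubst)
    fix t :: nat
    assume "t \<le> 53"
    then show "wp (Seq (RAssign 1 (nvar 1) (RPlus (RCell 1 (nvar 1)) (rvar 4)))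
        (Seq (RAssign 1 (nvar 2) (RPlus (RCell 1 (nvar 2)) (rvar 4)))
        (Seq (RAssign 2 (NConst 0) (RPlus (rvar 2) (rvar 4))) (incr 2))))
      (write_real 4 0 w s)
      (\<lambda>u s'. t + u \<le> 84 \<and> nats s' 1 0 = i \<and> nats s' 2 0 = Suc j \<and> pending D \<theta> es s')"
      using assms(1-4) r served
      by (intro wp_Seq wp_RAssign wp_NAssign) (simp add: pending_def ready_def fun_upd_def add.assoc)
  qed
qed

lemma wp_row_com:
  assumes "nats s 1 0 = i" "i < length D" "pending D \<theta> (sqdiffs_from D i) s"
  shows "wp row_com s
    (\<lambda>t s'. t \<le> 90 * length D + 18 \<and> nats s' 1 0 = Suc i \<and> pending D \<theta> (sqdiffs_from D (Suc i)) s')"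
proof -
  let ?n = "length D"
  \<comment> \<open>The edges left when the column counter is \<open>j\<close>: the rest of row
    \<open>i\<close>, then all later rows.\<close>
  define es where "es j = map (sqdiff D i) [j..<?n] @ sqdiffs_from D (Suc i)" for j
  have es_step: "es j = sqdiff D i j # es (Suc j)" if "j < ?n" for j
    using that by (simp add: es_def upt_conv_Cons)
  have es_Suc: "es (Suc i) = sqdiffs_from D i"
    using assms(2) by (simp add: es_def sqdiffs_from_def upt_conv_Cons[of i])
  have es_n: "es ?n = sqdiffs_from D (Suc i)" by (simp add: es_def)
  let ?I = "\<lambda>k s. nats s 1 0 = i \<and> nats s 2 0 = Suc i + k \<and> pending D \<theta> (es (Suc i + k)) s"
  have n: "nats s 0 0 = ?n" if "pending D \<theta> es' s" for es' s
    using that by (simp add: pending_def ready_def)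
  have loop: "wp (While (NLess (nvar 2) (nvar 0)) serve_com) s'
      (\<lambda>t s''. t \<le> 90 * ?n + 6 \<and> nats s'' 1 0 = i \<and> pending D \<theta> (sqdiffs_from D (Suc i)) s'')"
    if "?I 0 s'" for s'
  proof (rule wp_While[where m = "?n - Suc i" and B = 84 and I = ?I])
    show "?I 0 s'" by (fact that)
  next
    fix k s
    assume k: "k < ?n - Suc i" and I: "?I k s"
    then have "nats s 0 0 = ?n" using n by blast
    with k I show "bval (NLess (nvar 2) (nvar 0)) s \<and>
        wp serve_com s (\<lambda>t s'. t \<le> 84 \<and> ?I (Suc k) s')"
      using wp_serve_com[of s i "Suc i + k" D \<theta> "es (Suc (Suc i + k))"] es_step[of "Suc i + k"]
      by simp
  next
    fix s
    assume "?I (?n - Suc i) s"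
    then show "\<not> bval (NLess (nvar 2) (nvar 0)) s" using n by auto
  next
    fix t s'
    assume t: "t \<le> (?n - Suc i) * (1 + bcost (NLess (nvar 2) (nvar 0)) + 84) + 1
        + bcost (NLess (nvar 2) (nvar 0))" and I: "?I (?n - Suc i) s'"
    have "Suc i + (?n - Suc i) = ?n" using assms(2) by simp
    then have "es (Suc i + (?n - Suc i)) = sqdiffs_from D (Suc i)" by (simp only: es_n)
    with t I show "t \<le> 90 * ?n + 6 \<and> nats s' 1 0 = i \<and> pending D \<theta> (sqdiffs_from D (Suc i)) s'"
      by auto
  qed
  show ?thesis
    unfolding row_com_def
    apply (intro wp_Seq wp_NAssign)
    apply (rule wp_mono[OF loop])
    subgoal using assms by (simp add: es_Suc pending_def ready_def)
    subgoal by (intro wp_NAssign) (auto simp: pending_def ready_def)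
    done
qed

lemma wp_clipped_Var_com:
  "wp (clipped_Var_com \<Delta>) (input_store D)
     (\<lambda>t s. t \<le> 90 * (length D)\<^sup>2 + 42 * length D + 34 \<and> reals s 0 0 = clipped_Var \<Delta> D)"
proof -
  let ?n = "length D"
  define \<theta> where "\<theta> = \<Delta> / 4 * (real ?n)\<^sup>2"
  let ?I = "\<lambda>i s. nats s 1 0 = i \<and> pending D \<theta> (sqdiffs_from D i) s"
  have loop: "wp (While (NLess (nvar 1) (nvar 0)) row_com) s
      (\<lambda>t s'. t \<le> ?n * (90 * ?n + 24) + 6 \<and> ?I ?n s')" if "?I 0 s" for s
  proof (rule wp_While[where m = ?n and B = "90 * ?n + 18" and I = ?I])
    show "?I 0 s" by (fact that)
  next
    fix i s
    assume "i < ?n" "?I i s"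
    then show "bval (NLess (nvar 1) (nvar 0)) s \<and>
        wp row_com s (\<lambda>t s'. t \<le> 90 * ?n + 18 \<and> ?I (Suc i) s')"
      using wp_row_com[of s i D \<theta>] by (simp add: pending_def ready_def)
  qed (auto simp: pending_def ready_def algebra_simps)
  \<comment> \<open>After the last row no edges are left, so the invariant gives the whole greedy
    total. On the empty database the program and \<open>clipped_Var\<close> both divide 0 by 0,
    which is 0.\<close>
  have final: "wp (RAssign 0 (NConst 0) (RDivide (rvar 2) (RTimes (rvar 3) (rvar 3)))) s
      (\<lambda>t s'. t = 10 \<and> reals s' 0 0 = clipped_Var \<Delta> D)" if "?I ?n s" for s
    using that
    by (intro wp_RAssign) (simp add: pending_def ready_def sqdiffs_from_def clipped_Var_def
        \<theta>_def power2_eq_square)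
  show ?thesis
    unfolding clipped_Var_com_def
    apply (intro wp_Seq)
    apply (rule wp_mono[OF wp_count_com], elim conjE, hypsubst)
    apply (intro wp_Seq wp_RAssign wp_NAssign)
    apply (rule wp_mono[OF loop])
    subgoal
      by (simp add: pending_def ready_def input_store_def \<theta>_def power2_eq_square)
    subgoal
      by (elim conjE, rule wp_mono[OF final]) (auto simp: power2_eq_square algebra_simps)
    done
qed

lemma clipped_Var_computable:
  "\<exists>c T. computes_within c (clipped_Var \<Delta>) T \<and> (\<lambda>n. real (T n)) \<in> O(\<lambda>n. real n ^ 2)"
proof (intro exI conjI)
  let ?T = "\<lambda>n::nat. 90 * n\<^sup>2 + 42 * n + 34"
  show "computes_within (clipped_Var_com \<Delta>) (clipped_Var \<Delta>) ?T"
    using wp_clipped_Var_com unfolding computes_within_def wp_def by blast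
  show "(\<lambda>n. real (?T n)) \<in> O(\<lambda>n. real n ^ 2)"
  proof (rule bigoI)
    \<comment> \<open>\<open>166 = 90 + 42 + 34\<close>, as \<open>n\<close> and 1 are at most
      \<open>n * n\<close> for \<open>n \<ge> 1\<close>.\<close>
    show "\<forall>\<^sub>F n in sequentially. norm (real (?T n)) \<le> 166 * norm (real n ^ 2)"
      using eventually_ge_at_top[of 1]
    proof eventually_elim
      case (elim n)
      then have "n \<le> n * n" "1 \<le> n * n" by simp_all
      then have "?T n \<le> 166 * n\<^sup>2" unfolding power2_eq_square by linarith
      then have "real (?T n) \<le> real (166 * n\<^sup>2)" by (rule of_nat_mono)
      then show ?case by simp
    qed
  qed
qed

theorem theorem1p7:
  fixes \<Delta> :: real
  assumes "\<Delta> \<ge> 0"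
  shows "\<exists>g :: real list \<Rightarrow> real.
           has_sensitivity g \<Delta> \<and>
           (\<exists>c T. computes_within c g T \<and> (\<lambda>n. real (T n)) \<in> O(\<lambda>n. real n ^ 2)) \<and>
           (\<forall>D. \<bar>g D - Var D\<bar> \<le>
                  max (Var D - real (length D) / 2 * \<Delta>) 0 +
                  (\<Sum>i<length D.
                     max ((\<Sum>j<length D. 4 * (D ! i - D ! j)\<^sup>2 / (real (length D))\<^sup>2) - \<Delta>) 0))"
proof (intro exI[of _ "clipped_Var \<Delta>"] conjI allI)
  show "has_sensitivity (clipped_Var \<Delta>) \<Delta>"
    using assms by (rule clipped_Var_sensitivity)
  show "\<exists>c T. computes_within c (clipped_Var \<Delta>) T \<and> (\<lambda>n. real (T n)) \<in> O(\<lambda>n. real n ^ 2)"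
    by (rule clipped_Var_computable)
  show "\<bar>clipped_Var \<Delta> D - Var D\<bar> \<le>
      max (Var D - real (length D) / 2 * \<Delta>) 0 +
      (\<Sum>i<length D.
         max ((\<Sum>j<length D. 4 * (D ! i - D ! j)\<^sup>2 / (real (length D))\<^sup>2) - \<Delta>) 0)" for D
    using clipped_Var_error[OF assms, of D] by linarith
qed

end
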